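(* If $\mathcal{F}$ and $\mathcal{G}$ are nonprincipal filters on $\omega$ and $\mathcal{G}$ is a P-filter, then $\mathcal{F}\otimes\mathcal{G}$ is cofinally equivalent to $\mathcal{F}\times\mathcal{G}\times\omega^\omega$. Therefore, if $\mathcal{F}$ is also a P-filter, then $\mathcal{F}\otimes\mathcal{G}$ is cofinally equivalent to $\mathcal{G}\otimes\mathcal{F}$.
   Context: Filters on $\omega$ are ordered by containment $\supseteq$ (smaller sets are greater); products, including $\omega^\omega$ (all functions $\omega\to\omega$), have the coordinatewise order. Preorders $P$ and $Q$ are cofinally equivalent if there is a preorder $R$ such that $P$ and $Q$ are order isomorphic to cofinal subsets of $R$. A nonprincipal filter $\mathcal{F}$ on $\omega$ is a P-filter if for every sequence $(A_i:i<\omega)$ of elements of $\mathcal{F}$ there is $B\in\mathcal{F}$ such that $B\subseteq^* A_i$ (i.e. $B\setminus A_i$ is finite) for all $i<\omega$. Fix a pairing function (bijection) $\langle\cdot,\cdot\rangle$ from $\omega\times\omega$ to $\omega$; for $E\subseteq\omega$ and $i\in\omega$ let $(E)_i=\{j:\langle i,j\rangle\in E\}$. The Fubini product of filters $\mathcal{F},\mathcal{G}$ on $\omega$ is the filter $\mathcal{F}\otimes\mathcal{G}=\{E\subseteq\omega:\{i:(E)_i\in\mathcal{G}\}\in\mathcal{F}\}$ on $\omega$. *)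

theory Defs
  imports Complex_Main
begin

section \<open>Cofinal equivalence of preorders\<close>

text \<open>A preorder is a relation \<open>r\<close> with \<open>preorder_on (Field r) r\<close>; its underlying set is
  \<open>Field r\<close>, and \<open>(x, y) \<in> r\<close> means \<open>x \<le> y\<close>.\<close>

text \<open>The constant \<open>BNF_Cardinal_Arithmetic.cofinal\<close> is not used: it asks for strictly larger
  elements.\<close>

definition cofinal_subset :: "'a set \<Rightarrow> 'a rel \<Rightarrow> bool" where
  "cofinal_subset C r \<longleftrightarrow> C \<subseteq> Field r \<and> (\<forall>x\<in>Field r. \<exists>y\<in>C. (x, y) \<in> r)"

definition order_isomorphic :: "'a rel \<Rightarrow> 'b rel \<Rightarrow> bool" where
  "order_isomorphic r s \<longleftrightarrow>
     (\<exists>f. bij_betw f (Field r) (Field s) \<and>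
          (\<forall>x\<in>Field r. \<forall>y\<in>Field r. (x, y) \<in> r \<longleftrightarrow> (f x, f y) \<in> s))"

text \<open>HOL cannot quantify over the type on which the common preorder lives, so it is placed on
  \<open>'a + 'b\<close>. Lemma \<open>cofinally_equivalentI\<close> below shows that this loses nothing: a common preorder
  on any type whatsoever suffices.\<close>

definition cofinally_equivalent :: "'a rel \<Rightarrow> 'b rel \<Rightarrow> bool" where
  "cofinally_equivalent r s \<longleftrightarrow>
     (\<exists>R :: ('a + 'b) rel. preorder_on (Field R) R \<and>
        (\<exists>C. cofinal_subset C R \<and> order_isomorphic r (Restr R C)) \<and>
        (\<exists>D. cofinal_subset D R \<and> order_isomorphic s (Restr R D)))"

lemma Field_Restr_preorder:
  assumes "preorder_on (Field R) R" "C \<subseteq> Field R"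
  shows "Field (Restr R C) = C"
  using assms by (fastforce simp: preorder_on_def refl_on_def Field_def)

lemma cofinally_equivalentI:
  fixes r :: "'a rel" and s :: "'b rel" and R :: "'c rel"
  assumes R: "preorder_on (Field R) R"
    and C: "cofinal_subset C R" and rC: "order_isomorphic r (Restr R C)"
    and D: "cofinal_subset D R" and sD: "order_isomorphic s (Restr R D)"
  shows "cofinally_equivalent r s"
proof -
  have CF: "C \<subseteq> Field R" and DF: "D \<subseteq> Field R"
    using C D by (auto simp: cofinal_subset_def)
  have refl: "(x, x) \<in> R" if "x \<in> Field R" for x
    using R that by (auto simp: preorder_on_def refl_on_def)
  have R_trans: "(x, z) \<in> R" if "(x, y) \<in> R" "(y, z) \<in> R" for x y z
    using R that by (auto simp: preorder_on_def dest: transD)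
  obtain f where f: "bij_betw f (Field r) C"
    and f': "\<And>x y. x \<in> Field r \<Longrightarrow> y \<in> Field r \<Longrightarrow> (x, y) \<in> r \<longleftrightarrow> (f x, f y) \<in> Restr R C"
    using rC Field_Restr_preorder[OF R CF] by (auto simp: order_isomorphic_def)
  obtain g where g: "bij_betw g (Field s) D"
    and g': "\<And>x y. x \<in> Field s \<Longrightarrow> y \<in> Field s \<Longrightarrow> (x, y) \<in> s \<longleftrightarrow> (g x, g y) \<in> Restr R D"
    using sD Field_Restr_preorder[OF R DF] by (auto simp: order_isomorphic_def)
  have fC: "f x \<in> C" if "x \<in> Field r" for x using f that by (auto simp: bij_betw_def)
  have gD: "g x \<in> D" if "x \<in> Field s" for x using g that by (auto simp: bij_betw_def)
  define h where "h = case_sum f g"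
  define A where "A = Inl ` Field r \<union> Inr ` Field s"
  define T where "T = {(x, y). x \<in> A \<and> y \<in> A \<and> (h x, h y) \<in> R}"
  have hF: "h x \<in> Field R" if "x \<in> A" for x
    using that fC gD CF DF by (auto simp: A_def h_def)
  have FT: "Field T = A"
    using refl[OF hF] by (auto simp: T_def Field_def)
  have T: "preorder_on (Field T) T"
    unfolding FT preorder_on_def
  proof (intro conjI)
    show "T \<subseteq> A \<times> A" by (auto simp: T_def)
    show "refl_on A T" using refl[OF hF] by (auto simp: T_def refl_on_def)
    show "trans T" by (rule transI) (auto simp: T_def intro: R_trans)
  qed
  have c1: "cofinal_subset (Inl ` Field r) T"
  proof -
    have "\<exists>y\<in>Inl ` Field r. (x, y) \<in> T" if x: "x \<in> A" for x
    proof -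
      obtain c where c: "c \<in> C" "(h x, c) \<in> R"
        using C hF[OF x] by (auto simp: cofinal_subset_def)
      then obtain a where "a \<in> Field r" "c = f a"
        using f by (auto simp: bij_betw_def)
      with c x show ?thesis by (auto simp: T_def A_def h_def)
    qed
    then show ?thesis by (auto simp: cofinal_subset_def FT) (auto simp: A_def)
  qed
  have c2: "cofinal_subset (Inr ` Field s) T"
  proof -
    have "\<exists>y\<in>Inr ` Field s. (x, y) \<in> T" if x: "x \<in> A" for x
    proof -
      obtain c where c: "c \<in> D" "(h x, c) \<in> R"
        using D hF[OF x] by (auto simp: cofinal_subset_def)
      then obtain a where "a \<in> Field s" "c = g a"
        using g by (auto simp: bij_betw_def)
      with c x show ?thesis by (auto simp: T_def A_def h_def)
    qed
    then show ?thesis by (auto simp: cofinal_subset_def FT) (auto simp: A_def)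
  qed
  have F1: "Field (Restr T (Inl ` Field r)) = Inl ` Field r"
    by (rule Field_Restr_preorder[OF T]) (use c1 in \<open>auto simp: cofinal_subset_def\<close>)
  have F2: "Field (Restr T (Inr ` Field s)) = Inr ` Field s"
    by (rule Field_Restr_preorder[OF T]) (use c2 in \<open>auto simp: cofinal_subset_def\<close>)
  have i1: "order_isomorphic r (Restr T (Inl ` Field r))"
    unfolding order_isomorphic_def F1
    by (rule exI[of _ Inl]) (auto simp: bij_betw_def T_def A_def h_def f' fC)
  have i2: "order_isomorphic s (Restr T (Inr ` Field s))"
    unfolding order_isomorphic_def F2
    by (rule exI[of _ Inr]) (auto simp: bij_betw_def T_def A_def h_def g' gD)
  show ?thesis
    unfolding cofinally_equivalent_def using T c1 c2 i1 i2 by blast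
qed

section \<open>The preorders\<close>

text \<open>Filters are elements of the library type \<^typ>\<open>nat filter\<close>. The order between filters
  provided by that type plays no role; what is ordered are the members of one filter.\<close>

definition filter_sets :: "'a filter \<Rightarrow> 'a set set" where
  "filter_sets F = {A. eventually (\<lambda>x. x \<in> A) F}"

definition filter_order :: "'a filter \<Rightarrow> 'a set rel" where
  "filter_order F = {(A, B). A \<in> filter_sets F \<and> B \<in> filter_sets F \<and> A \<supseteq> B}"

definition prod_order :: "'a rel \<Rightarrow> 'b rel \<Rightarrow> ('a \<times> 'b) rel" where
  "prod_order r s = {((a, b), (a', b')). (a, a') \<in> r \<and> (b, b') \<in> s}"

text \<open>The library order on functions is the coordinatewise (everywhere, not eventual) one.\<close>

definition baire_order :: "(nat \<Rightarrow> nat) rel" where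
  "baire_order = {(f, g). f \<le> g}"

lemma preorder_filter_order: "preorder_on (filter_sets F) (filter_order F)"
  by (auto simp: preorder_on_def filter_order_def refl_on_def intro!: transI)

lemma preorder_prod_order:
  "preorder_on A r \<Longrightarrow> preorder_on B s \<Longrightarrow> preorder_on (A \<times> B) (prod_order r s)"
  by (auto simp: preorder_on_def refl_on_def prod_order_def intro!: transI dest: transD)

lemma preorder_baire_order: "preorder_on UNIV baire_order"
  by (auto simp: preorder_on_def baire_order_def refl_on_def intro!: transI)

section \<open>Nonprincipal filters, P-filters, Fubini products\<close>

text \<open>Since \<open>bot = principal {}\<close>, a nonprincipal filter is proper. Every proper filter that
  contains all cofinite sets is nonprincipal in this sense.\<close>

definition nonprincipal :: "'a filter \<Rightarrow> bool" where
  "nonprincipal F \<longleftrightarrow> (\<forall>S. F \<noteq> principal S)"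

lemma nonprincipal_if_le_cofinite:
  assumes "F \<noteq> bot" "F \<le> cofinite"
  shows "nonprincipal F"
  unfolding nonprincipal_def
proof (intro allI notI)
  fix S assume F: "F = principal S"
  have "a \<notin> S" for a
  proof -
    have "eventually (\<lambda>x. x \<noteq> a) F"
      using assms(2) by (rule filter_leD) (simp add: eventually_cofinite)
    then show ?thesis by (auto simp: F eventually_principal)
  qed
  then have "S = {}" by blast
  with F assms(1) show False by simp
qed

definition P_filter :: "nat filter \<Rightarrow> bool" where
  "P_filter F \<longleftrightarrow> nonprincipal F \<and>
     (\<forall>A :: nat \<Rightarrow> nat set. (\<forall>i. A i \<in> filter_sets F) \<longrightarrow>
        (\<exists>B\<in>filter_sets F. \<forall>i. finite (B - A i)))"

definition fiber :: "(nat \<times> nat \<Rightarrow> nat) \<Rightarrow> nat set \<Rightarrow> nat \<Rightarrow> nat set" where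
  "fiber p E i = {j. p (i, j) \<in> E}"

definition fubini_product :: "(nat \<times> nat \<Rightarrow> nat) \<Rightarrow> nat filter \<Rightarrow> nat filter \<Rightarrow> nat filter" where
  "fubini_product p F G =
     Abs_filter (\<lambda>P. eventually (\<lambda>i. eventually (\<lambda>j. P (p (i, j))) G) F)"

lemma eventually_fubini_product:
  "eventually P (fubini_product p F G) \<longleftrightarrow>
     eventually (\<lambda>i. eventually (\<lambda>j. P (p (i, j))) G) F"
  unfolding fubini_product_def
proof (rule eventually_Abs_filter, rule is_filter.intro)
  fix P Q
  assume "eventually (\<lambda>i. eventually (\<lambda>j. P (p (i, j))) G) F"
    and "eventually (\<lambda>i. eventually (\<lambda>j. Q (p (i, j))) G) F"
  then show "eventually (\<lambda>i. eventually (\<lambda>j. P (p (i, j)) \<and> Q (p (i, j))) G) F"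
    by eventually_elim (rule eventually_conj)
next
  fix P Q :: "nat \<Rightarrow> bool"
  assume "\<forall>x. P x \<longrightarrow> Q x"
    and "eventually (\<lambda>i. eventually (\<lambda>j. P (p (i, j))) G) F"
  then show "eventually (\<lambda>i. eventually (\<lambda>j. Q (p (i, j))) G) F"
    by (auto elim!: eventually_mono)
qed simp

lemma filter_sets_fubini_product:
  "filter_sets (fubini_product p F G) = {E. {i. fiber p E i \<in> filter_sets G} \<in> filter_sets F}"
  by (simp add: filter_sets_def fiber_def eventually_fubini_product)

end

theory Submission
  imports Defs "HOL-Library.Infinite_Set"
begin

text \<open>
  Cofinal equivalence of directed preorders is Tukey bireducibility, so the theorem reduces to
  exhibiting Tukey reductions in both directions; these compose and respect products, and the
  second claim follows because \<open>F \<times> G \<times> \<omega>\<^sup>\<omega>\<close> is symmetric in \<open>F\<close> and \<open>G\<close>.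

  \<^item> \<open>F \<otimes> G\<close> reduces to \<open>F \<times> G \<times> \<omega>\<^sup>\<omega>\<close>: send \<open>(A, B, f)\<close> to the set whose fiber over \<open>i \<in> A\<close> is \<open>B\<close>
    with the part below \<open>f i\<close> removed. This is monotone, and it is cofinal because the
    P-filter \<open>G\<close> contains one \<open>B\<close> that is almost contained in each of the countably many fibers
    of a given \<open>E\<close> that belong to \<open>G\<close>; \<open>f\<close> bounds the finitely many exceptions in each fiber.
  \<^item> \<open>F \<times> G \<times> \<omega>\<^sup>\<omega>\<close> reduces to \<open>F \<otimes> G\<close>: since \<open>F \<otimes> G\<close> is directed, each factor can be treated
    separately. \<open>F\<close> is recovered from the set of \<open>i\<close> with large fiber, \<open>G\<close> from any
    single large fiber. For \<open>\<omega>\<^sup>\<omega>\<close>, a function is coded by the set of points above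
    its running maximum; a member of \<open>F \<otimes> G\<close> inside that set yields bounds at infinitely many
    places, which is enough because running maxima are increasing.

  A nonprincipal filter need not contain the cofinite sets here: the intersection \<open>K\<close> of all its
  members may be nonempty. It does contain \<open>K \<union> {n..}\<close> for each \<open>n\<close>, and each of its members has
  infinitely many elements outside \<open>K\<close>. Tails are therefore always taken relative to \<open>K\<close>.
\<close>

section \<open>Tukey reductions and cofinal equivalence\<close>

definition directed_rel :: "'a rel \<Rightarrow> bool" where
  "directed_rel r \<longleftrightarrow> (\<forall>x\<in>Field r. \<forall>y\<in>Field r. \<exists>z\<in>Field r. (x, z) \<in> r \<and> (y, z) \<in> r)"

text \<open>The witness \<open>f\<close> is a Tukey map: preimages of bounded sets are bounded.\<close>

definition tukey_le :: "'a rel \<Rightarrow> 'b rel \<Rightarrow> bool" where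
  "tukey_le r s \<longleftrightarrow> (\<exists>f. f ` Field r \<subseteq> Field s \<and>
     (\<forall>y\<in>Field s. \<exists>z\<in>Field r. \<forall>x\<in>Field r. (f x, y) \<in> s \<longrightarrow> (x, z) \<in> r))"

lemma tukey_leE:
  assumes "tukey_le r s"
  obtains f g where "\<And>x. x \<in> Field r \<Longrightarrow> f x \<in> Field s" "\<And>y. y \<in> Field s \<Longrightarrow> g y \<in> Field r"
    "\<And>x y. x \<in> Field r \<Longrightarrow> (f x, y) \<in> s \<Longrightarrow> (x, g y) \<in> r"
proof -
  obtain f where f: "f ` Field r \<subseteq> Field s"
    and "\<forall>y\<in>Field s. \<exists>z\<in>Field r. \<forall>x\<in>Field r. (f x, y) \<in> s \<longrightarrow> (x, z) \<in> r"
    using assms unfolding tukey_le_def by blast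
  then obtain g where g: "\<forall>y\<in>Field s. g y \<in> Field r \<and> (\<forall>x\<in>Field r. (f x, y) \<in> s \<longrightarrow> (x, g y) \<in> r)"
    by metis
  show thesis
    by (rule that[of f g]) (use f g in \<open>auto intro: FieldI2\<close>)
qed

lemma tukey_le_trans:
  assumes "tukey_le r s" "tukey_le s t"
  shows "tukey_le r t"
proof -
  obtain f g where f: "\<And>x. x \<in> Field r \<Longrightarrow> f x \<in> Field s" "\<And>y. y \<in> Field s \<Longrightarrow> g y \<in> Field r"
    "\<And>x y. x \<in> Field r \<Longrightarrow> (f x, y) \<in> s \<Longrightarrow> (x, g y) \<in> r"
    using assms(1) by (rule tukey_leE) blast
  obtain f' g' where f': "\<And>x. x \<in> Field s \<Longrightarrow> f' x \<in> Field t" "\<And>y. y \<in> Field t \<Longrightarrow> g' y \<in> Field s"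
    "\<And>x y. x \<in> Field s \<Longrightarrow> (f' x, y) \<in> t \<Longrightarrow> (x, g' y) \<in> s"
    using assms(2) by (rule tukey_leE) blast
  show ?thesis
    unfolding tukey_le_def
  proof (intro exI conjI ballI)
    show "(f' \<circ> f) ` Field r \<subseteq> Field t"
      using f(1) f'(1) by auto
    fix z assume "z \<in> Field t"
    then show "\<exists>w\<in>Field r. \<forall>x\<in>Field r. ((f' \<circ> f) x, z) \<in> t \<longrightarrow> (x, w) \<in> r"
      using f f' by (intro bexI[of _ "g (g' z)"]) simp_all
  qed
qed

text \<open>A Tukey map is obtained from a monotone map \<open>h\<close> with cofinal image by sending each \<open>x\<close> to
  some \<open>y\<close> with \<open>h y\<close> above \<open>x\<close>.\<close>

lemma tukey_le_if_mono_cofinal: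
  assumes trans: "trans r"
    and h: "\<And>y. y \<in> Field s \<Longrightarrow> h y \<in> Field r"
    and mono: "\<And>y y'. (y, y') \<in> s \<Longrightarrow> (h y, h y') \<in> r"
    and cofinal: "\<And>x. x \<in> Field r \<Longrightarrow> \<exists>y\<in>Field s. (x, h y) \<in> r"
  shows "tukey_le r s"
proof -
  obtain f where f: "\<forall>x\<in>Field r. f x \<in> Field s \<and> (x, h (f x)) \<in> r"
    using cofinal by metis
  then show ?thesis
    unfolding tukey_le_def using h mono trans by (intro exI[of _ f]) (blast dest: transD)
qed

text \<open>Tukey's theorem. The Tukey maps and their duals are first merged, using directedness, into
  \<open>u\<close> and \<open>v\<close> with \<open>u x \<le> y \<Longrightarrow> x \<le> v y\<close> and \<open>v y \<le> x \<Longrightarrow> y \<le> u x\<close>. The common preorder lives on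
  the disjoint union: putting \<open>x\<close> below \<open>u x\<close> and \<open>y\<close> below \<open>v y\<close> and closing under transitivity adds
  no new relations inside either summand.\<close>

theorem cofinally_equivalent_if_tukey_equivalent:
  assumes r: "preorder_on (Field r) r" "directed_rel r"
    and s: "preorder_on (Field s) s" "directed_rel s"
    and rs: "tukey_le r s" and sr: "tukey_le s r"
  shows "cofinally_equivalent r s"
proof -
  have r_refl: "\<And>x. x \<in> Field r \<Longrightarrow> (x, x) \<in> r" and s_refl: "\<And>x. x \<in> Field s \<Longrightarrow> (x, x) \<in> s"
    using r s by (auto simp: preorder_on_def refl_on_def)
  have r_trans: "\<And>x y z. (x, y) \<in> r \<Longrightarrow> (y, z) \<in> r \<Longrightarrow> (x, z) \<in> r"
    and s_trans: "\<And>x y z. (x, y) \<in> s \<Longrightarrow> (y, z) \<in> s \<Longrightarrow> (x, z) \<in> s"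
    using r s by (auto simp: preorder_on_def dest: transD)
  obtain f g where f: "\<And>x. x \<in> Field r \<Longrightarrow> f x \<in> Field s" "\<And>y. y \<in> Field s \<Longrightarrow> g y \<in> Field r"
    "\<And>x y. x \<in> Field r \<Longrightarrow> (f x, y) \<in> s \<Longrightarrow> (x, g y) \<in> r"
    using rs by (rule tukey_leE) blast
  obtain f' g' where f': "\<And>y. y \<in> Field s \<Longrightarrow> f' y \<in> Field r" "\<And>x. x \<in> Field r \<Longrightarrow> g' x \<in> Field s"
    "\<And>y x. y \<in> Field s \<Longrightarrow> (f' y, x) \<in> r \<Longrightarrow> (y, g' x) \<in> s"
    using sr by (rule tukey_leE) blast
  have "\<forall>x\<in>Field r. \<exists>z\<in>Field s. (f x, z) \<in> s \<and> (g' x, z) \<in> s"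
    using s(2) f(1) f'(2) unfolding directed_rel_def by blast
  then obtain u where u: "\<forall>x\<in>Field r. u x \<in> Field s \<and> (f x, u x) \<in> s \<and> (g' x, u x) \<in> s"
    by metis
  have "\<forall>y\<in>Field s. \<exists>z\<in>Field r. (g y, z) \<in> r \<and> (f' y, z) \<in> r"
    using r(2) f(2) f'(1) unfolding directed_rel_def by blast
  then obtain v where v: "\<forall>y\<in>Field s. v y \<in> Field r \<and> (g y, v y) \<in> r \<and> (f' y, v y) \<in> r"
    by metis
  have uv: "(x, v y) \<in> r" if "x \<in> Field r" "(u x, y) \<in> s" for x y
    using that u v f(3) r_trans s_trans by (meson FieldI2)
  have vu: "(y, u x) \<in> s" if "y \<in> Field s" "(v y, x) \<in> r" for x y
    using that u v f'(3) r_trans s_trans by (meson FieldI2)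
  define R :: "('a + 'b) rel" where "R = {(z, w). case (z, w) of
      (Inl x, Inl x') \<Rightarrow> (x, x') \<in> r
    | (Inr y, Inr y') \<Rightarrow> (y, y') \<in> s
    | (Inl x, Inr y) \<Rightarrow> \<exists>x0. (x, x0) \<in> r \<and> (u x0, y) \<in> s
    | (Inr y, Inl x) \<Rightarrow> \<exists>y0. (y, y0) \<in> s \<and> (v y0, x) \<in> r}"
  have R_simps: "(Inl x, Inl x') \<in> R \<longleftrightarrow> (x, x') \<in> r"
    "(Inr y, Inr y') \<in> R \<longleftrightarrow> (y, y') \<in> s"
    "(Inl x, Inr y) \<in> R \<longleftrightarrow> (\<exists>x0. (x, x0) \<in> r \<and> (u x0, y) \<in> s)"
    "(Inr y, Inl x) \<in> R \<longleftrightarrow> (\<exists>y0. (y, y0) \<in> s \<and> (v y0, x) \<in> r)" for x x' y y'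
    by (simp_all add: R_def)
  let ?A = "Inl ` Field r \<union> Inr ` Field s"
  have R_sub: "z \<in> ?A \<and> w \<in> ?A" if "(z, w) \<in> R" for z w
    using that by (cases z; cases w) (auto simp: R_simps Field_def)
  have R_refl: "(z, z) \<in> R" if "z \<in> ?A" for z
    using that r_refl s_refl by (auto simp: R_simps)
  have FR: "Field R = ?A"
  proof
    show "Field R \<subseteq> ?A"
      unfolding Field_def[of R] using R_sub by blast
    show "?A \<subseteq> Field R"
      using R_refl by (blast intro: FieldI1)
  qed
  \<comment> \<open>A detour through the other summand creates no new relation within a summand.\<close>
  have rsr: "(x, x') \<in> r" if "(x, x0) \<in> r" "(u x0, y) \<in> s" "(y, y0) \<in> s" "(v y0, x') \<in> r"
    for x x0 y y0 x'
    using that uv[of x0 y0] r_trans s_trans by (meson FieldI2)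
  have srs: "(y, y') \<in> s" if "(y, y0) \<in> s" "(v y0, x) \<in> r" "(x, x0) \<in> r" "(u x0, y') \<in> s"
    for y y0 x x0 y'
    using that vu[of y0 x0] r_trans s_trans by (meson FieldI2)
  have R_trans: "trans R"
  proof (rule transI)
    fix a b c assume "(a, b) \<in> R" "(b, c) \<in> R"
    then show "(a, c) \<in> R"
      by (cases a; cases b; cases c; simp only: R_simps) (meson r_trans s_trans rsr srs)+
  qed
  have R: "preorder_on (Field R) R"
    using R_sub R_refl R_trans unfolding FR preorder_on_def refl_on_def by auto
  have ul: "(Inl x, Inr (u x)) \<in> R" if "x \<in> Field r" for x
    using that u r_refl s_refl by (auto simp: R_simps)
  have vl: "(Inr y, Inl (v y)) \<in> R" if "y \<in> Field s" for y
    using that v r_refl s_refl by (auto simp: R_simps)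
  have C: "cofinal_subset (Inl ` Field r) R"
    unfolding cofinal_subset_def FR using R_refl vl v by blast
  have D: "cofinal_subset (Inr ` Field s) R"
    unfolding cofinal_subset_def FR using R_refl ul u by blast
  have FC: "Field (Restr R (Inl ` Field r)) = Inl ` Field r"
    and FD: "Field (Restr R (Inr ` Field s)) = Inr ` Field s"
    using C D Field_Restr_preorder[OF R] by (auto simp: cofinal_subset_def)
  have rC: "order_isomorphic r (Restr R (Inl ` Field r))"
    unfolding order_isomorphic_def FC by (rule exI[of _ Inl]) (auto simp: bij_betw_def R_simps)
  have sD: "order_isomorphic s (Restr R (Inr ` Field s))"
    unfolding order_isomorphic_def FD by (rule exI[of _ Inr]) (auto simp: bij_betw_def R_simps)
  show ?thesis
    by (rule cofinally_equivalentI[OF R C rC D sD])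
qed

section \<open>Products\<close>

lemma Field_preorder: "preorder_on A r \<Longrightarrow> Field r = A"
  by (auto simp: preorder_on_def refl_on_def Field_def)

lemma Field_prod_order:
  assumes "preorder_on (Field r) r" "preorder_on (Field s) s"
  shows "Field (prod_order r s) = Field r \<times> Field s"
  by (rule Field_preorder[OF preorder_prod_order[OF assms]])

lemma directed_prod_order:
  assumes "preorder_on (Field r) r" "preorder_on (Field s) s" "directed_rel r" "directed_rel s"
  shows "directed_rel (prod_order r s)"
  using assms(3,4) unfolding directed_rel_def Field_prod_order[OF assms(1,2)]
  by (fastforce simp: prod_order_def)

text \<open>Directedness of the target lets the Tukey maps of the two factors be merged.\<close>

lemma tukey_le_prod_order:
  assumes r: "preorder_on (Field r) r" and s: "preorder_on (Field s) s"
    and t: "trans t" "directed_rel t"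
    and rt: "tukey_le r t" and st: "tukey_le s t"
  shows "tukey_le (prod_order r s) t"
proof -
  obtain f g where f: "\<And>x. x \<in> Field r \<Longrightarrow> f x \<in> Field t" "\<And>y. y \<in> Field t \<Longrightarrow> g y \<in> Field r"
    "\<And>x y. x \<in> Field r \<Longrightarrow> (f x, y) \<in> t \<Longrightarrow> (x, g y) \<in> r"
    using rt by (rule tukey_leE) blast
  obtain f' g' where f': "\<And>x. x \<in> Field s \<Longrightarrow> f' x \<in> Field t" "\<And>y. y \<in> Field t \<Longrightarrow> g' y \<in> Field s"
    "\<And>x y. x \<in> Field s \<Longrightarrow> (f' x, y) \<in> t \<Longrightarrow> (x, g' y) \<in> s"
    using st by (rule tukey_leE) blast
  have "\<forall>z\<in>Field r \<times> Field s. \<exists>w\<in>Field t. (f (fst z), w) \<in> t \<and> (f' (snd z), w) \<in> t"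
    using t(2) f(1) f'(1) unfolding directed_rel_def by auto
  then obtain h where h: "\<forall>z\<in>Field r \<times> Field s.
      h z \<in> Field t \<and> (f (fst z), h z) \<in> t \<and> (f' (snd z), h z) \<in> t"
    by metis
  have bound: "(z, (g w, g' w)) \<in> prod_order r s"
    if z: "z \<in> Field r \<times> Field s" and zw: "(h z, w) \<in> t" for z w
  proof -
    have "(f (fst z), w) \<in> t" "(f' (snd z), w) \<in> t"
      using h z zw t(1) by (blast dest: transD)+
    then show ?thesis
      using z f(3) f'(3) by (cases z) (auto simp: prod_order_def)
  qed
  show ?thesis
    unfolding tukey_le_def Field_prod_order[OF r s]
  proof (intro exI conjI ballI)
    show "h ` (Field r \<times> Field s) \<subseteq> Field t"
      using h by blast
    fix w assume "w \<in> Field t"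
    then show "\<exists>v\<in>Field r \<times> Field s. \<forall>z\<in>Field r \<times> Field s. (h z, w) \<in> t \<longrightarrow> (z, v) \<in> prod_order r s"
      using bound f(2) f'(2) by (intro bexI[of _ "(g w, g' w)"]) auto
  qed
qed

lemma tukey_le_prod_order_swap:
  assumes r: "preorder_on (Field r) r" and s: "preorder_on (Field s) s"
    and t: "preorder_on (Field t) t"
  shows "tukey_le (prod_order r (prod_order s t)) (prod_order s (prod_order r t))"
proof -
  have "Field (prod_order r (prod_order s t)) = Field r \<times> Field s \<times> Field t"
    and "Field (prod_order s (prod_order r t)) = Field s \<times> Field r \<times> Field t"
    by (intro Field_preorder preorder_prod_order r s t)+
  then show ?thesis
    unfolding tukey_le_def
    by (intro exI[of _ "\<lambda>(x, y, z). (y, x, z)"]) (fastforce simp: prod_order_def)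
qed

section \<open>Filters\<close>

lemma Field_filter_order [simp]: "Field (filter_order F) = filter_sets F"
  by (rule Field_preorder[OF preorder_filter_order])

lemma filter_order_iff:
  "(A, B) \<in> filter_order F \<longleftrightarrow> A \<in> filter_sets F \<and> B \<in> filter_sets F \<and> B \<subseteq> A"
  by (auto simp: filter_order_def)

lemma filter_sets_Int: "A \<in> filter_sets F \<Longrightarrow> B \<in> filter_sets F \<Longrightarrow> A \<inter> B \<in> filter_sets F"
  by (simp add: filter_sets_def eventually_conj)

lemma filter_sets_mono: "A \<in> filter_sets F \<Longrightarrow> A \<subseteq> B \<Longrightarrow> B \<in> filter_sets F"
  by (auto simp: filter_sets_def elim: eventually_mono)

lemma UNIV_in_filter_sets [simp]: "UNIV \<in> filter_sets F"
  by (simp add: filter_sets_def)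

lemma directed_filter_order: "directed_rel (filter_order F)"
  unfolding directed_rel_def
  by (simp add: filter_order_iff) (meson Int_lower1 Int_lower2 filter_sets_Int)

lemma trans_filter_order: "trans (filter_order F)"
  using preorder_filter_order by (auto simp: preorder_on_def)

lemma Field_baire_order [simp]: "Field baire_order = UNIV"
  by (rule Field_preorder[OF preorder_baire_order])

lemma baire_order_iff: "(f, g) \<in> baire_order \<longleftrightarrow> f \<le> g"
  by (simp add: baire_order_def)

lemma directed_baire_order: "directed_rel baire_order"
  unfolding directed_rel_def by (simp add: baire_order_iff) (meson sup_ge1 sup_ge2)

definition filter_kernel :: "'a filter \<Rightarrow> 'a set" where
  "filter_kernel F = \<Inter> (filter_sets F)"

text \<open>Each point outside the kernel is omitted by some member, and finitely many such members intersect
  to a member.\<close>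

lemma Compl_finite_in_filter_sets:
  assumes "finite S" "S \<inter> filter_kernel F = {}"
  shows "- S \<in> filter_sets F"
proof -
  have "eventually (\<lambda>x. x \<noteq> a) F" if a: "a \<in> S" for a
  proof -
    obtain A where "A \<in> filter_sets F" "a \<notin> A"
      using a assms(2) by (auto simp: filter_kernel_def)
    then show ?thesis
      by (auto simp: filter_sets_def elim!: eventually_mono)
  qed
  then have "eventually (\<lambda>x. \<forall>a\<in>S. x \<noteq> a) F"
    using assms(1) by (simp add: eventually_ball_finite)
  then show ?thesis
    by (auto simp: filter_sets_def elim!: eventually_mono)
qed

lemma kernel_Un_atLeast_in_filter_sets: "filter_kernel F \<union> {n..} \<in> filter_sets (F :: nat filter)"
proof -
  have "- ({..<n} - filter_kernel F) \<in> filter_sets F"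
    by (rule Compl_finite_in_filter_sets) auto
  then show ?thesis
    by (rule filter_sets_mono) auto
qed

text \<open>Otherwise the kernel would itself be a member, hence the least one, and generate the filter.\<close>

lemma infinite_diff_kernel:
  assumes "nonprincipal F" "A \<in> filter_sets F"
  shows "infinite (A - filter_kernel F)"
proof
  assume "finite (A - filter_kernel F)"
  then have "A \<inter> - (A - filter_kernel F) \<in> filter_sets F"
    by (intro filter_sets_Int assms Compl_finite_in_filter_sets) auto
  then have K: "filter_kernel F \<in> filter_sets F"
    by (rule filter_sets_mono) auto
  have "eventually P F \<longleftrightarrow> (\<forall>x\<in>filter_kernel F. P x)" for P
  proof
    assume "eventually P F"
    then have "{x. P x} \<in> filter_sets F"
      by (simp add: filter_sets_def)
    then show "\<forall>x\<in>filter_kernel F. P x"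
      by (auto simp: filter_kernel_def)
  next
    assume "\<forall>x\<in>filter_kernel F. P x"
    then show "eventually P F"
      using K by (auto simp: filter_sets_def elim: eventually_mono)
  qed
  then have "F = principal (filter_kernel F)"
    by (simp add: filter_eq_iff eventually_principal)
  with assms(1) show False
    by (auto simp: nonprincipal_def)
qed

lemma infinite_filter_set: "nonprincipal F \<Longrightarrow> A \<in> filter_sets F \<Longrightarrow> infinite A"
  using infinite_diff_kernel by blast

section \<open>Reductions between the Fubini product and its factors\<close>

lemma fiber_image_Sigma:
  assumes "bij p"
  shows "fiber p (p ` Sigma A S) i = (if i \<in> A then S i else {})"
  using assms by (auto simp: fiber_def inj_image_mem_iff bij_is_inj)

lemma fiber_mono: "D \<subseteq> E \<Longrightarrow> fiber p D i \<subseteq> fiber p E i"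
  by (auto simp: fiber_def)

lemma image_Sigma_subset_if_fiber:
  assumes "\<And>i. i \<in> A \<Longrightarrow> S i \<subseteq> fiber p E i"
  shows "p ` Sigma A S \<subseteq> E"
  using assms by (fastforce simp: fiber_def)

lemma image_Sigma_in_fubini_product:
  assumes "bij p" "A \<in> filter_sets F" "\<And>i. i \<in> A \<Longrightarrow> S i \<in> filter_sets G"
  shows "p ` Sigma A S \<in> filter_sets (fubini_product p F G)"
  unfolding filter_sets_fubini_product using assms
  by (auto simp: fiber_image_Sigma intro: filter_sets_mono)

text \<open>Nonprincipality of \<open>G\<close> makes the cylinder over \<open>A\<close> remember \<open>A\<close>: its empty fibers are not
  members of \<open>G\<close>.\<close>

lemma tukey_le_fubini_left:
  assumes p: "bij p" and G: "nonprincipal G"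
  shows "tukey_le (filter_order F) (filter_order (fubini_product p F G))"
proof (rule tukey_le_if_mono_cofinal[where h = "\<lambda>E. {i. fiber p E i \<in> filter_sets G}"])
  fix A assume A: "A \<in> Field (filter_order F)"
  have "{} \<notin> filter_sets G"
    using infinite_filter_set[OF G] by blast
  then have "{i. fiber p (p ` (A \<times> UNIV)) i \<in> filter_sets G} = A"
    using p by (auto simp: fiber_image_Sigma)
  moreover have "p ` (A \<times> UNIV) \<in> filter_sets (fubini_product p F G)"
    using p A by (intro image_Sigma_in_fubini_product) auto
  ultimately show "\<exists>E\<in>Field (filter_order (fubini_product p F G)).
      (A, {i. fiber p E i \<in> filter_sets G}) \<in> filter_order F"
    using A by (auto simp: filter_order_iff intro!: bexI)
next
  fix D E assume "(D, E) \<in> filter_order (fubini_product p F G)"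
  then show "({i. fiber p D i \<in> filter_sets G}, {i. fiber p E i \<in> filter_sets G}) \<in> filter_order F"
    by (auto simp: filter_order_iff filter_sets_fubini_product
        intro: filter_sets_mono[OF _ fiber_mono])
qed (auto simp: trans_filter_order filter_sets_fubini_product)

text \<open>A member of \<open>F \<otimes> G\<close> that lies in the cylinder \<open>\<omega> \<times> B\<close> has all its fibers inside \<open>B\<close>, so any one
  fiber in \<open>G\<close> bounds every such \<open>B\<close> at once. Some fiber is in \<open>G\<close> because \<open>F\<close> is proper.\<close>

lemma tukey_le_fubini_right:
  assumes p: "bij p" and F: "nonprincipal F"
  shows "tukey_le (filter_order G) (filter_order (fubini_product p F G))"
  unfolding tukey_le_def
proof (intro exI conjI ballI)
  show "(\<lambda>B. p ` (UNIV \<times> B)) ` Field (filter_order G) \<subseteq> Field (filter_order (fubini_product p F G))"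
    using p by (auto intro!: image_Sigma_in_fubini_product[unfolded subset_eq])
  fix E assume "E \<in> Field (filter_order (fubini_product p F G))"
  then have "{i. fiber p E i \<in> filter_sets G} \<in> filter_sets F"
    by (simp add: filter_sets_fubini_product)
  then have "{i. fiber p E i \<in> filter_sets G} \<noteq> {}"
    using infinite_filter_set[OF F] by fastforce
  then obtain i where i: "fiber p E i \<in> filter_sets G"
    by blast
  have "fiber p E i \<subseteq> B" if "E \<subseteq> p ` (UNIV \<times> B)" for B
    using fiber_mono[OF that, of p i] p by (simp add: fiber_image_Sigma)
  then show "\<exists>C\<in>Field (filter_order G). \<forall>B\<in>Field (filter_order G).
      (p ` (UNIV \<times> B), E) \<in> filter_order (fubini_product p F G) \<longrightarrow> (B, C) \<in> filter_order G"
    using i by (intro bexI[of _ "fiber p E i"]) (auto simp: filter_order_iff)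
qed

text \<open>A member \<open>E\<close> of the Fubini product has, for each \<open>n\<close>, a large fiber over some \<open>i \<ge> n\<close>, and that
  fiber contains a point \<open>j\<close> outside the kernel. If \<open>E\<close> lies inside the set coding \<open>f\<close>, then \<open>j\<close> is at
  least the maximum of \<open>f\<close> on \<open>{..i}\<close>, hence at least \<open>f n\<close>; the choice of \<open>j\<close> depends on \<open>E\<close> and \<open>n\<close>
  only.\<close>

lemma tukey_le_fubini_baire:
  assumes p: "bij p" and F: "nonprincipal F" and G: "nonprincipal G"
  shows "tukey_le baire_order (filter_order (fubini_product p F G))"
  unfolding tukey_le_def
proof (intro exI conjI ballI)
  let ?S = "\<lambda>f i. filter_kernel G \<union> {Max (f ` {..i}) ..}"
  let ?c = "\<lambda>f. p ` Sigma UNIV (?S f)"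
  show "?c ` Field baire_order \<subseteq> Field (filter_order (fubini_product p F G))"
  proof
    fix D assume "D \<in> ?c ` Field baire_order"
    then obtain f :: "nat \<Rightarrow> nat" where "D = ?c f"
      by blast
    then show "D \<in> Field (filter_order (fubini_product p F G))"
      using p kernel_Un_atLeast_in_filter_sets by (simp add: image_Sigma_in_fubini_product)
  qed
  fix E assume "E \<in> Field (filter_order (fubini_product p F G))"
  then have large: "{i. fiber p E i \<in> filter_sets G} \<in> filter_sets F"
    by (simp add: filter_sets_fubini_product)
  have "\<exists>i\<ge>n. \<exists>j. j \<in> fiber p E i - filter_kernel G" for n
  proof -
    obtain i where i: "i \<ge> n" "fiber p E i \<in> filter_sets G"
      using infinite_filter_set[OF F large] by (auto simp: infinite_nat_iff_unbounded_le)
    have "fiber p E i - filter_kernel G \<noteq> {}"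
      using infinite_diff_kernel[OF G i(2)] by fastforce
    with i(1) show ?thesis
      by blast
  qed
  then obtain b where b: "\<And>n. \<exists>i\<ge>n. b n \<in> fiber p E i - filter_kernel G"
    by metis
  have "f n \<le> b n" if E: "E \<subseteq> ?c f" for f n
  proof -
    obtain i where i: "i \<ge> n" "b n \<in> fiber p E i" "b n \<notin> filter_kernel G"
      using b by blast
    have "b n \<in> ?S f i"
      using fiber_mono[OF E, of p i] i(2) p by (auto simp: fiber_image_Sigma)
    then have le: "Max (f ` {..i}) \<le> b n"
      using i(3) by (simp del: Max_le_iff)
    have "f n \<le> Max (f ` {..i})"
      using i(1) by (intro Max_ge) auto
    then show ?thesis
      using le by (rule order_trans)
  qed
  then show "\<exists>g\<in>Field baire_order. \<forall>f\<in>Field baire_order.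
      (?c f, E) \<in> filter_order (fubini_product p F G) \<longrightarrow> (f, g) \<in> baire_order"
    by (intro bexI[of _ b]) (auto simp: filter_order_iff baire_order_iff le_fun_def)
qed

lemma preorder_filter_baire:
  "preorder_on (filter_sets F \<times> filter_sets G \<times> UNIV)
     (prod_order (filter_order F) (prod_order (filter_order G) baire_order))"
  by (intro preorder_prod_order preorder_filter_order preorder_baire_order)

lemmas Field_filter_baire = preorder_filter_baire[THEN Field_preorder]

text \<open>The P-filter property trades the possibly different fibers of \<open>E\<close> for a single \<open>B\<close> together
  with a function \<open>f\<close> that bounds \<open>B - fiber p E i\<close>. Cutting \<open>B\<close> below \<open>f i\<close> keeps the kernel
  points, which lie in every fiber that belongs to \<open>G\<close>.\<close>

lemma tukey_le_fubini_product_of_P_filter: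
  assumes p: "bij p" and G: "P_filter G"
  shows "tukey_le (filter_order (fubini_product p F G))
    (prod_order (filter_order F) (prod_order (filter_order G) baire_order))"
proof -
  let ?S = "\<lambda>B f i. B \<inter> (filter_kernel G \<union> {f i..})"
  let ?h = "\<lambda>(A, B, f). p ` Sigma A (?S B f)"
  have h: "p ` Sigma A (?S B f) \<in> filter_sets (fubini_product p F G)"
    if "A \<in> filter_sets F" "B \<in> filter_sets G" for A B f
    using p that by (intro image_Sigma_in_fubini_product filter_sets_Int kernel_Un_atLeast_in_filter_sets)
  show ?thesis
  proof (rule tukey_le_if_mono_cofinal[where h = ?h])
    fix z w assume "(z, w) \<in> prod_order (filter_order F) (prod_order (filter_order G) baire_order)"
    then obtain A B f A' B' f' where zw: "z = (A, B, f)" "w = (A', B', f')"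
      and AB: "A \<in> filter_sets F" "A' \<in> filter_sets F" "B \<in> filter_sets G" "B' \<in> filter_sets G"
      and le: "A' \<subseteq> A" "B' \<subseteq> B" "f \<le> f'"
      by (auto simp: prod_order_def filter_order_iff baire_order_iff)
    have "?S B' f' i \<subseteq> ?S B f i" for i
      using le(2) le_funD[OF le(3), of i] by auto
    then have "p ` Sigma A' (?S B' f') \<subseteq> p ` Sigma A (?S B f)"
      using le(1) by (intro image_mono Sigma_mono)
    then show "(?h z, ?h w) \<in> filter_order (fubini_product p F G)"
      using h AB by (simp add: zw filter_order_iff)
  next
    fix E assume "E \<in> Field (filter_order (fubini_product p F G))"
    then have E: "E \<in> filter_sets (fubini_product p F G)"
      by simp
    define A where "A = {i. fiber p E i \<in> filter_sets G}"
    have A: "A \<in> filter_sets F"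
      using E by (simp add: A_def filter_sets_fubini_product)
    \<comment> \<open>Small fibers are replaced by \<open>UNIV\<close> so that every term of the sequence belongs to \<open>G\<close>.\<close>
    define D where "D = (\<lambda>i. if i \<in> A then fiber p E i else UNIV)"
    have "\<forall>i. D i \<in> filter_sets G"
      by (simp add: A_def D_def)
    then have "\<exists>B\<in>filter_sets G. \<forall>i. finite (B - D i)"
      using G by (simp add: P_filter_def)
    then obtain B where B: "B \<in> filter_sets G" and fin: "\<forall>i. finite (B - D i)"
      by blast
    have "\<forall>i\<in>A. \<exists>n. \<forall>j\<in>B - fiber p E i. j < n"
    proof
      fix i assume "i \<in> A"
      then have "finite (B - fiber p E i)"
        using fin[rule_format, of i] by (simp add: D_def)
      then show "\<exists>n. \<forall>j\<in>B - fiber p E i. j < n"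
        by (simp only: finite_nat_set_iff_bounded)
    qed
    then obtain f where f: "\<forall>i\<in>A. \<forall>j\<in>B - fiber p E i. j < f i"
      by (auto dest: bchoice)
    have "?S B f i \<subseteq> fiber p E i" if i: "i \<in> A" for i
    proof -
      have "filter_kernel G \<subseteq> fiber p E i"
        using i by (auto simp: A_def filter_kernel_def)
      then show ?thesis
        using f i by (fastforce simp: not_less[symmetric])
    qed
    then have "p ` Sigma A (?S B f) \<subseteq> E"
      by (rule image_Sigma_subset_if_fiber)
    then have "(E, ?h (A, B, f)) \<in> filter_order (fubini_product p F G)"
      using E h[OF A B] by (simp add: filter_order_iff)
    then show "\<exists>z\<in>Field (prod_order (filter_order F) (prod_order (filter_order G) baire_order)).
        (E, ?h z) \<in> filter_order (fubini_product p F G)"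
      using A B by (intro bexI[of _ "(A, B, f)"]) (auto simp: Field_filter_baire)
  qed (auto simp: trans_filter_order Field_filter_baire h)
qed

lemma tukey_le_product_fubini:
  assumes "bij p" "nonprincipal F" "nonprincipal G"
  shows "tukey_le (prod_order (filter_order F) (prod_order (filter_order G) baire_order))
    (filter_order (fubini_product p F G))"
proof -
  have pre: "preorder_on (Field (filter_order H)) (filter_order H)" for H :: "nat filter"
    by (simp add: preorder_filter_order)
  have preB: "preorder_on (Field baire_order) baire_order"
    by (simp add: preorder_baire_order)
  have preGB: "preorder_on (Field (prod_order (filter_order G) baire_order))
      (prod_order (filter_order G) baire_order)"
    using preorder_prod_order[OF pre preB] Field_prod_order[OF pre preB] by metis
  show ?thesis
    using assms
    by (intro tukey_le_prod_order pre preB preGB trans_filter_order directed_filter_order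
        tukey_le_fubini_left tukey_le_fubini_right tukey_le_fubini_baire)
qed

section \<open>Cofinal type of the Fubini product\<close>

theorem theorem5p4:
  fixes p :: "nat \<times> nat \<Rightarrow> nat" and F G :: "nat filter"
  assumes "bij p"
    and "nonprincipal F" and "nonprincipal G" and "P_filter G"
  shows "cofinally_equivalent (filter_order (fubini_product p F G))
           (prod_order (filter_order F) (prod_order (filter_order G) baire_order)) \<and>
         (P_filter F \<longrightarrow>
           cofinally_equivalent (filter_order (fubini_product p F G))
             (filter_order (fubini_product p G F)))"
proof (intro conjI impI)
  have pre: "preorder_on (Field (filter_order H)) (filter_order H)" for H :: "nat filter"
    by (simp add: preorder_filter_order)
  have preB: "preorder_on (Field baire_order) baire_order"
    by (simp add: preorder_baire_order)
  let ?P = "\<lambda>F G. prod_order (filter_order F) (prod_order (filter_order G) baire_order)"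
  have preP: "preorder_on (Field (?P F G)) (?P F G)"
    using preorder_filter_baire by (simp add: Field_filter_baire)
  have preGB: "preorder_on (Field (prod_order (filter_order G) baire_order))
      (prod_order (filter_order G) baire_order)"
    using preorder_prod_order[OF pre preB] Field_prod_order[OF pre preB] by metis
  have dirP: "directed_rel (?P F G)"
    by (intro directed_prod_order pre preB preGB directed_filter_order directed_baire_order)
  have le: "tukey_le (filter_order (fubini_product p F G)) (?P F G)"
    using assms by (intro tukey_le_fubini_product_of_P_filter)
  have ge: "tukey_le (?P F G) (filter_order (fubini_product p F G))"
    using assms by (intro tukey_le_product_fubini)
  show "cofinally_equivalent (filter_order (fubini_product p F G)) (?P F G)"
    by (intro cofinally_equivalent_if_tukey_equivalent pre preP directed_filter_order dirP le ge)
  have swap: "tukey_le (?P H H') (?P H' H)" for H H' :: "nat filter"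
    by (intro tukey_le_prod_order_swap pre preB)
  assume F: "P_filter F"
  have le': "tukey_le (filter_order (fubini_product p G F)) (?P G F)"
    using assms F by (intro tukey_le_fubini_product_of_P_filter)
  have ge': "tukey_le (?P G F) (filter_order (fubini_product p G F))"
    using assms by (intro tukey_le_product_fubini)
  show "cofinally_equivalent (filter_order (fubini_product p F G))
      (filter_order (fubini_product p G F))"
    by (intro cofinally_equivalent_if_tukey_equivalent pre directed_filter_order
        tukey_le_trans[OF le tukey_le_trans[OF swap ge']]
        tukey_le_trans[OF le' tukey_le_trans[OF swap ge]])
qed

end
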